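(* Assume that there exist a family $\{\kappa_\epsilon\}_{\epsilon}$ of strictly positive constants and a Borel measurable function $\bar w:\Theta\to\mathbb R_+$, $\pi$-integrable and not $\pi$-almost surely equal to zero, such that $$\lim_{\epsilon\downarrow0}\int_\Theta\left|\frac1{\kappa_\epsilon}w_\epsilon(\theta)-\bar w(\theta)\right|\pi(d\theta)=0,$$ and suppose further that $\bar w>0$ $\pi$-a.s. Let $\bar\pi\in\mathscr P(\Theta)$ be given by $\bar\pi[B]:=\int_B\bar w\,d\pi\big/\int_\Theta\bar w\,d\pi$, $B\in\mathcal B(\Theta)$, and define, for every $\rho\in\mathscr P(\Theta)$, $$\widetilde{\mathcal F}_\epsilon(\rho):=\begin{cases}-\displaystyle\int_\Theta\log\Big[\frac1{\kappa_\epsilon}w_\epsilon(\theta)\Big]\rho(d\theta)+\mathrm{KL}(\rho\mid\pi),&\text{if }\rho\ll\pi,\\[1ex]\infty,&\text{otherwise,}\end{cases}$$ $$\bar{\mathcal F}(\rho):=-\log\int_\Theta\bar w(\theta)\,\pi(d\theta)+\mathrm{KL}(\rho\mid\bar\pi).$$ Then: (i) $\pi_\epsilon$ is the unique minimizer of $\widetilde{\mathcal F}_\epsilon$ on $\mathscr P(\Theta)$, with minimum value $$\min_{\rho\in\mathscr P(\Theta)}\widetilde{\mathcal F}_\epsilon(\rho)=\widetilde{\mathcal F}_\epsilon(\pi_\epsilon)=-\log\int_\Theta\frac1{\kappa_\epsilon}w_\epsilon(\theta)\,\pi(d\theta).$$ (ii) $\bar\pi$ is the unique minimizer of $\bar{\mathcal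 F}$ on $\mathscr P(\Theta)$, and $$\min_{\rho\in\mathscr P(\Theta)}\bar{\mathcal F}(\rho)=\bar{\mathcal F}(\bar\pi)=-\log\int_\Theta\bar w(\theta)\,\pi(d\theta).$$ (iii) $\displaystyle\lim_{\epsilon\downarrow0}\widetilde{\mathcal F}_\epsilon(\pi_\epsilon)=\bar{\mathcal F}(\bar\pi)$. (iv) If $\{\rho_\epsilon\}_{\epsilon>0}$ is any family in $\mathscr P(\Theta)$ of asymptotic minimizers, that is, $$\lim_{\epsilon\downarrow0}\big[\widetilde{\mathcal F}_\epsilon(\rho_\epsilon)-\widetilde{\mathcal F}_\epsilon(\pi_\epsilon)\big]=0,$$ then this family converges in total variation to $\bar\pi$, i.e. $\sup_{B\in\mathcal B(\Theta)}|\rho_\epsilon[B]-\bar\pi[B]|\to0$ as $\epsilon\downarrow0$.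
   Context: $\Theta\subseteq\mathbb R^{m_\Theta}$ is endowed with the topology induced by a metric $d_\Theta$; $\mathcal B(\Theta)$ is its Borel $\sigma$-algebra and $\mathscr P(\Theta)$ the set of probability measures on $\mathcal B(\Theta)$; $\mathbb R_+=[0,\infty)$. $\pi\in\mathscr P(\Theta)$ is a fixed prior. For each $\epsilon>0$, $w_\epsilon:\Theta\to\mathbb R_+$ is a Borel measurable function (compatibility weight) with $0<w_\epsilon\le1$ $\pi$-a.s. (up to modification on a $\pi$-null set, everywhere on $\Theta$), and $$\pi_\epsilon[B]:=\frac{\int_Bw_\epsilon(\theta)\,\pi(d\theta)}{\int_\Theta w_\epsilon(\theta')\,\pi(d\theta')},\qquad B\in\mathcal B(\Theta).$$ For $\rho,\sigma\in\mathscr P(\Theta)$, $\mathrm{KL}(\rho\mid\sigma):=\int_\Theta\log\frac{d\rho}{d\sigma}(\theta)\,\rho(d\theta)$ if $\rho\ll\sigma$, and $\mathrm{KL}(\rho\mid\sigma):=\infty$ otherwise. Functionals take values in the extended reals. *)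

theory Defs
  imports "HOL-Probability.Probability"
begin

text \<open>Borel sets of the metric topology on the carrier \<open>S\<close>; the metric \<open>d\<close> need not be the
  restriction of the ambient one.\<close>
definition borel_metric :: "'a set \<Rightarrow> ('a \<Rightarrow> 'a \<Rightarrow> real) \<Rightarrow> 'a measure" where
  "borel_metric S d = sigma S {U. openin (Metric_space.mtopology S d) U}"

abbreviation prob_measures :: "'a measure \<Rightarrow> 'a measure set" where
  "prob_measures B \<equiv> space (prob_algebra B)"

text \<open>The Bochner integral is \<open>0\<close> for non-integrable functions, so it cannot express integrals with
  an infinite value. The definition below is the usual one whenever the positive or the negative
  part of \<open>f\<close> has finite integral.\<close>
definition ext_integral :: "'a measure \<Rightarrow> ('a \<Rightarrow> real) \<Rightarrow> ereal" where
  "ext_integral M f =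
     enn2ereal (\<integral>\<^sup>+x. ennreal (f x) \<partial>M) - enn2ereal (\<integral>\<^sup>+x. ennreal (- f x) \<partial>M)"

lemma ext_integral_eq_integral:
  assumes "integrable M f"
  shows "ext_integral M f = ereal (integral\<^sup>L M f)"
proof -
  have "(\<integral>\<^sup>+x. ennreal (f x) \<partial>M) \<noteq> \<infinity>" "(\<integral>\<^sup>+x. ennreal (- f x) \<partial>M) \<noteq> \<infinity>"
    using assms by (auto simp: real_integrable_def)
  then show ?thesis
    unfolding ext_integral_def real_lebesgue_integral_def[OF assms]
    by (cases "\<integral>\<^sup>+x. ennreal (f x) \<partial>M"; cases "\<integral>\<^sup>+x. ennreal (- f x) \<partial>M") (auto simp: enn2ereal_ennreal)
qed

text \<open>\<open>KL \<rho> \<sigma>\<close> is \<open>KL(\<rho> | \<sigma>)\<close>. Mind the argument order: \<open>absolutely_continuous \<sigma> \<rho>\<close> means that \<open>\<rho>\<close> is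
  absolutely continuous with respect to \<open>\<sigma>\<close>, and \<open>entropy_density (exp 1) \<sigma> \<rho>\<close> is the natural
  logarithm of \<open>d\<rho>/d\<sigma>\<close>. This density is finite and positive \<open>\<rho>\<close>-almost everywhere, so its values
  at \<open>0\<close> and \<open>\<infinity>\<close> are irrelevant; its negative part is \<open>\<rho>\<close>-integrable. The library's
  \<open>KL_divergence\<close> is real-valued and hence not used.\<close>
definition KL :: "'a measure \<Rightarrow> 'a measure \<Rightarrow> ereal" where
  "KL \<rho> \<sigma> =
     (if absolutely_continuous \<sigma> \<rho> then ext_integral \<rho> (entropy_density (exp 1) \<sigma> \<rho>) else \<infinity>)"

definition tilt :: "'a measure \<Rightarrow> ('a \<Rightarrow> real) \<Rightarrow> 'a measure" where
  "tilt \<mu> f = density \<mu> (\<lambda>\<theta>. ennreal (f \<theta>) / (\<integral>\<^sup>+\<theta>'. ennreal (f \<theta>') \<partial>\<mu>))"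

lemma emeasure_tilt:
  assumes [measurable]: "f \<in> borel_measurable \<mu>" "B \<in> sets \<mu>"
  shows "emeasure (tilt \<mu> f) B =
    (\<integral>\<^sup>+\<theta>\<in>B. ennreal (f \<theta>) \<partial>\<mu>) / (\<integral>\<^sup>+\<theta>. ennreal (f \<theta>) \<partial>\<mu>)"
proof -
  let ?Z = "\<integral>\<^sup>+\<theta>. ennreal (f \<theta>) \<partial>\<mu>"
  have "emeasure (tilt \<mu> f) B = (\<integral>\<^sup>+\<theta>. (ennreal (f \<theta>) * indicator B \<theta>) * inverse ?Z \<partial>\<mu>)"
    unfolding tilt_def by (subst emeasure_density) (auto simp: divide_ennreal_def ac_simps)
  also have "\<dots> = (\<integral>\<^sup>+\<theta>. ennreal (f \<theta>) * indicator B \<theta> \<partial>\<mu>) * inverse ?Z"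
    by (rule nn_integral_multc) measurable
  finally show ?thesis by (simp add: divide_ennreal_def)
qed

text \<open>The logarithm is evaluated at positive arguments \<open>\<rho>\<close>-almost everywhere as soon as \<open>f > 0\<close>
  holds \<open>\<mu>\<close>-almost everywhere. If moreover \<open>f\<close> is bounded above, then the positive part of the
  logarithm has finite integral with respect to the probability measure \<open>\<rho>\<close>, so that
  both summands are greater than \<open>-\<infinity>\<close>.\<close>
definition F_tilde :: "'a measure \<Rightarrow> real \<Rightarrow> ('a \<Rightarrow> real) \<Rightarrow> 'a measure \<Rightarrow> ereal" where
  "F_tilde \<mu> k f \<rho> =
     (if absolutely_continuous \<mu> \<rho>
      then - ext_integral \<rho> (\<lambda>\<theta>. ln (1 / k * f \<theta>)) + KL \<rho> \<mu>
      else \<infinity>)"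

definition F_bar :: "'a measure \<Rightarrow> ('a \<Rightarrow> real) \<Rightarrow> 'a measure \<Rightarrow> ereal" where
  "F_bar \<mu> g \<rho> = ereal (- ln (\<integral>\<theta>. g \<theta> \<partial>\<mu>)) + KL \<rho> (tilt \<mu> g)"

definition unique_minimizer :: "('a \<Rightarrow> ereal) \<Rightarrow> 'a set \<Rightarrow> 'a \<Rightarrow> bool" where
  "unique_minimizer F A x \<longleftrightarrow> (\<forall>y. is_arg_min F (\<lambda>z. z \<in> A) y \<longleftrightarrow> y = x)"

end

theory Submission
  imports Defs
begin

text \<open>Writing \<open>Z\<close> for the mass of \<open>w\<^sub>\<epsilon> / \<kappa>\<^sub>\<epsilon>\<close>, the chain rule for densities gives
  \<open>F_tilde(\<rho>) = - ln Z + KL(\<rho> | \<pi>\<^sub>\<epsilon>)\<close>, so both minimisation problems reduce to \<open>KL \<ge> 0\<close> with equality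
  only for equal measures. This and the convergence of asymptotic minimisers follow from the
  Pinsker-type bound \<open>\<bar>\<rho>[E] - \<sigma>[E]\<bar> \<le> 2 sqrt (KL(\<rho> | \<sigma>))\<close>, combined for the latter with the total
  variation convergence of \<open>\<pi>\<^sub>\<epsilon>\<close>, which is immediate from the \<open>L\<^sup>1\<close> convergence of the weights.\<close>

lemma ext_integral_cong_AE:
  assumes "AE x in M. f x = g x"
  shows "ext_integral M f = ext_integral M g"
proof -
  have "(\<integral>\<^sup>+x. ennreal (f x) \<partial>M) = (\<integral>\<^sup>+x. ennreal (g x) \<partial>M)"
    by (rule nn_integral_cong_AE) (use assms in auto)
  moreover have "(\<integral>\<^sup>+x. ennreal (- f x) \<partial>M) = (\<integral>\<^sup>+x. ennreal (- g x) \<partial>M)"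
    by (rule nn_integral_cong_AE) (use assms in auto)
  ultimately show ?thesis by (simp add: ext_integral_def)
qed

lemma ext_integral_uminus:
  assumes "(\<integral>\<^sup>+x. ennreal (- f x) \<partial>M) \<noteq> \<infinity>"
  shows "ext_integral M (\<lambda>x. - f x) = - ext_integral M f"
  using assms unfolding ext_integral_def
  by (cases "\<integral>\<^sup>+x. ennreal (f x) \<partial>M"; cases "\<integral>\<^sup>+x. ennreal (- f x) \<partial>M")
    (auto simp: enn2ereal_ennreal)

lemma integrable_of_ext_integral_finite:
  assumes [measurable]: "f \<in> borel_measurable M"
    and "(\<integral>\<^sup>+x. ennreal (- f x) \<partial>M) \<noteq> \<infinity>" "ext_integral M f \<noteq> \<infinity>"
  shows "integrable M f"
  unfolding real_integrable_def using assms
  by (cases "\<integral>\<^sup>+x. ennreal (f x) \<partial>M"; cases "\<integral>\<^sup>+x. ennreal (- f x) \<partial>M")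
    (auto simp: enn2ereal_ennreal ext_integral_def)

lemma nn_integral_neg_add_finite:
  fixes f g :: "'a \<Rightarrow> real"
  assumes [measurable]: "f \<in> borel_measurable M" "g \<in> borel_measurable M"
    and f: "(\<integral>\<^sup>+x. ennreal (- f x) \<partial>M) \<noteq> \<infinity>" and g: "(\<integral>\<^sup>+x. ennreal (- g x) \<partial>M) \<noteq> \<infinity>"
  shows "(\<integral>\<^sup>+x. ennreal (- (f x + g x)) \<partial>M) \<noteq> \<infinity>"
proof -
  have "(\<integral>\<^sup>+x. ennreal (- (f x + g x)) \<partial>M) \<le> (\<integral>\<^sup>+x. ennreal (- f x) + ennreal (- g x) \<partial>M)"
  proof (rule nn_integral_mono)
    fix x
    have "ennreal (- (f x + g x)) \<le> ennreal (max 0 (- f x) + max 0 (- g x))"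
      by (rule ennreal_leI) simp
    then show "ennreal (- (f x + g x)) \<le> ennreal (- f x) + ennreal (- g x)" by simp
  qed
  also have "\<dots> = (\<integral>\<^sup>+x. ennreal (- f x) \<partial>M) + (\<integral>\<^sup>+x. ennreal (- g x) \<partial>M)"
    by (simp add: nn_integral_add)
  finally show ?thesis using f g by (auto simp: top_unique)
qed

lemma ext_integral_add:
  assumes [measurable]: "f \<in> borel_measurable M" "g \<in> borel_measurable M"
    and f: "(\<integral>\<^sup>+x. ennreal (- f x) \<partial>M) \<noteq> \<infinity>" and g: "(\<integral>\<^sup>+x. ennreal (- g x) \<partial>M) \<noteq> \<infinity>"
  shows "ext_integral M (\<lambda>x. f x + g x) = ext_integral M f + ext_integral M g"
proof -
  let ?p = "\<lambda>h. \<integral>\<^sup>+x. ennreal (h x) \<partial>M" and ?n = "\<lambda>h. \<integral>\<^sup>+x. ennreal (- h x) \<partial>M"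
  let ?s = "\<lambda>x. f x + g x"
  have pw: "ennreal (a + b) + ennreal (- a) + ennreal (- b) =
      ennreal (- (a + b)) + ennreal a + ennreal b" for a b :: real
  proof -
    have "max 0 (a + b) + max 0 (- a) + max 0 (- b) = max 0 (- (a + b)) + max 0 a + max 0 b"
      by (simp add: max_def)
    then have "ennreal (max 0 (a + b)) + ennreal (max 0 (- a)) + ennreal (max 0 (- b)) =
        ennreal (max 0 (- (a + b))) + ennreal (max 0 a) + ennreal (max 0 b)"
      by (metis ennreal_plus max.cobounded1 add_nonneg_nonneg)
    then show ?thesis by (simp only: ennreal_max_0)
  qed
  have "?p ?s + ?n f + ?n g = (\<integral>\<^sup>+x. ennreal (?s x) + ennreal (- f x) + ennreal (- g x) \<partial>M)"
    by (simp add: nn_integral_add)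
  also have "\<dots> = (\<integral>\<^sup>+x. ennreal (- ?s x) + ennreal (f x) + ennreal (g x) \<partial>M)"
    by (simp only: pw)
  also have "\<dots> = ?n ?s + ?p f + ?p g"
    by (simp add: nn_integral_add)
  finally have eq: "?p ?s + ?n f + ?n g = ?n ?s + ?p f + ?p g" .
  have "?n ?s \<noteq> \<infinity>" by (rule nn_integral_neg_add_finite) fact+
  with eq f g show ?thesis unfolding ext_integral_def
    by (cases "?p ?s"; cases "?n ?s"; cases "?p f"; cases "?p g"; cases "?n f"; cases "?n g")
      (auto simp: enn2ereal_ennreal ennreal_plus[symmetric] simp del: ennreal_plus)
qed

lemma KL_density_eq:
  assumes "sigma_finite_measure \<sigma>" and [measurable]: "f \<in> borel_measurable \<sigma>"
    and f: "\<And>x. 0 \<le> f x" and \<rho>: "\<rho> = density \<sigma> (\<lambda>x. ennreal (f x))"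
  shows "KL \<rho> \<sigma> = ext_integral \<rho> (\<lambda>x. ln (f x))"
proof -
  interpret sigma_finite_measure \<sigma> by fact
  have ac: "absolutely_continuous \<sigma> \<rho>"
    unfolding \<rho> by (rule absolutely_continuousI_density) measurable
  have "AE x in \<sigma>. ennreal (f x) = RN_deriv \<sigma> \<rho> x"
    by (rule RN_deriv_unique) (auto simp: \<rho>)
  then have "AE x in \<sigma>. entropy_density (exp 1) \<sigma> \<rho> x = ln (f x)"
  proof eventually_elim
    case (elim x)
    then show ?case using f by (simp add: entropy_density_def log_def flip: elim)
  qed
  then have "AE x in \<rho>. entropy_density (exp 1) \<sigma> \<rho> x = ln (f x)"
    by (rule absolutely_continuous_AE[OF _ ac, rotated]) (simp add: \<rho>)
  then show ?thesis using ac by (simp add: KL_def ext_integral_cong_AE)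
qed

lemma abs_cont_prob_density:
  assumes "prob_space \<sigma>" "prob_space \<rho>" "sets \<rho> = sets \<sigma>" "absolutely_continuous \<sigma> \<rho>"
  obtains f :: "'a \<Rightarrow> real" where "f \<in> borel_measurable \<sigma>" "\<And>x. 0 \<le> f x"
    "AE x in \<rho>. 0 < f x" "\<rho> = density \<sigma> (\<lambda>x. ennreal (f x))"
proof -
  interpret \<sigma>: prob_space \<sigma> by fact
  interpret \<rho>: prob_space \<rho> by fact
  obtain f where f: "f \<in> borel_measurable \<sigma>" "AE x in \<sigma>. RN_deriv \<sigma> \<rho> x = ennreal (f x)"
    "AE x in \<rho>. 0 < f x" "\<And>x. 0 \<le> f x"
    using \<sigma>.real_RN_deriv[OF \<rho>.finite_measure_axioms assms(4,3)] by metis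
  have "density \<sigma> (RN_deriv \<sigma> \<rho>) = density \<sigma> (\<lambda>x. ennreal (f x))"
    by (rule density_cong) (use f in auto)
  with \<sigma>.density_RN_deriv[OF assms(4,3)] f that show thesis by metis
qed

lemma nn_integral_neg_ln_density_le:
  assumes "prob_space \<sigma>" and [measurable]: "f \<in> borel_measurable \<sigma>"
    and f: "\<And>x. 0 \<le> f x" and \<rho>: "\<rho> = density \<sigma> (\<lambda>x. ennreal (f x))"
  shows "(\<integral>\<^sup>+x. ennreal (- ln (f x)) \<partial>\<rho>) \<le> 1"
proof -
  interpret prob_space \<sigma> by fact
  have pw: "y * (- ln y) \<le> 1" if "0 \<le> y" for y :: real
  proof (cases "y = 0")
    case False
    with that have "0 < y" by simp
    with ln_le_minus_one[of "1 / y"] have "- ln y \<le> 1 / y - 1"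
      by (simp add: ln_div)
    with \<open>0 < y\<close> have "y * (- ln y) \<le> y * (1 / y - 1)"
      by (intro mult_left_mono) auto
    with \<open>0 < y\<close> show ?thesis by (simp add: algebra_simps)
  qed simp
  have "(\<integral>\<^sup>+x. ennreal (- ln (f x)) \<partial>\<rho>) = (\<integral>\<^sup>+x. ennreal (f x * (- ln (f x))) \<partial>\<sigma>)"
    unfolding \<rho> by (subst nn_integral_density) (simp_all add: f ennreal_mult'[OF f, symmetric])
  also have "\<dots> \<le> (\<integral>\<^sup>+x. 1 \<partial>\<sigma>)"
    by (rule nn_integral_mono) (use pw[OF f] in \<open>metis ennreal_leI ennreal_1\<close>)
  finally show ?thesis by (simp add: emeasure_space_1)
qed

text \<open>With \<open>s = sqrt y\<close>, AM-GM bounds \<open>\<bar>y - 1\<bar> = \<bar>s - 1\<bar> (s + 1)\<close>, and \<open>ln s \<ge> 1 - 1 / s\<close> gives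
  \<open>(s - 1)\<^sup>2 \<le> y ln y - y + 1\<close>.\<close>
lemma abs_diff_one_le_entropy:
  fixes y t :: real
  assumes "0 \<le> y" "0 < t"
  shows "\<bar>y - 1\<bar> \<le> (y * ln y - y + 1) / (2 * t) + t * (y + 1)"
proof -
  define s where "s = sqrt y"
  have s: "0 \<le> s" "y = s\<^sup>2" using assms by (auto simp: s_def)
  have ent: "(s - 1)\<^sup>2 \<le> y * ln y - y + 1"
  proof (cases "s = 0")
    case False
    with s have "0 < s" by simp
    with ln_le_minus_one[of "1 / s"] have "1 - 1 / s \<le> ln s" by (simp add: ln_div)
    with \<open>0 < s\<close> have "2 * s\<^sup>2 * (1 - 1 / s) \<le> 2 * s\<^sup>2 * ln s" by (intro mult_left_mono) auto
    moreover have "2 * s\<^sup>2 * (1 - 1 / s) = 2 * s\<^sup>2 - 2 * s"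
      using \<open>0 < s\<close> by (simp add: field_simps power2_eq_square)
    moreover have "ln y = 2 * ln s" using \<open>0 < s\<close> by (simp add: s ln_realpow)
    ultimately show ?thesis by (simp add: s power2_diff)
  qed (simp add: s)
  have "\<bar>y - 1\<bar> = \<bar>s - 1\<bar> * (s + 1)"
  proof -
    have "y - 1 = (s - 1) * (s + 1)" using s by (simp add: power2_eq_square algebra_simps)
    with s show ?thesis by (simp add: abs_mult)
  qed
  also have "\<dots> \<le> (s - 1)\<^sup>2 / (2 * t) + t * (s + 1)\<^sup>2 / 2"
  proof -
    have "0 \<le> (\<bar>s - 1\<bar> - t * (s + 1))\<^sup>2 / (2 * t)" using \<open>0 < t\<close> by simp
    also have "\<dots> = (s - 1)\<^sup>2 / (2 * t) + t * (s + 1)\<^sup>2 / 2 - \<bar>s - 1\<bar> * (s + 1)"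
      using \<open>0 < t\<close> unfolding power2_diff[of "\<bar>s - 1\<bar>"]
      by (simp add: field_simps power2_eq_square)
    finally show ?thesis by simp
  qed
  also have "\<dots> \<le> (y * ln y - y + 1) / (2 * t) + t * (y + 1)"
  proof (rule add_mono)
    show "(s - 1)\<^sup>2 / (2 * t) \<le> (y * ln y - y + 1) / (2 * t)"
      using ent \<open>0 < t\<close> by (intro divide_right_mono) auto
    have "(s + 1)\<^sup>2 / 2 \<le> y + 1"
      using sum_power2_ge_zero[of "s - 1" 0] by (simp add: s power2_eq_square algebra_simps)
    with \<open>0 < t\<close> show "t * (s + 1)\<^sup>2 / 2 \<le> t * (y + 1)"
      using mult_left_mono[of "(s + 1)\<^sup>2 / 2" "y + 1" t] by simp
  qed
  finally show ?thesis .
qed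

lemma KL_finite_obtain_measure_diff_bound:
  assumes "prob_space \<sigma>" "prob_space \<rho>" "sets \<rho> = sets \<sigma>" "KL \<rho> \<sigma> \<noteq> \<infinity>"
  obtains K where "KL \<rho> \<sigma> = ereal K"
    "\<And>E t. E \<in> sets \<sigma> \<Longrightarrow> 0 < t \<Longrightarrow> \<bar>measure \<rho> E - measure \<sigma> E\<bar> \<le> K / (2 * t) + 2 * t"
proof -
  interpret \<sigma>: prob_space \<sigma> by fact
  interpret \<rho>: prob_space \<rho> by fact
  have ac: "absolutely_continuous \<sigma> \<rho>" using assms(4) by (auto simp: KL_def split: if_splits)
  obtain f where f[measurable]: "f \<in> borel_measurable \<sigma>" and f0: "\<And>x. 0 \<le> f x"
    and \<rho>: "\<rho> = density \<sigma> (\<lambda>x. ennreal (f x))"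
    using abs_cont_prob_density[OF assms(1-3) ac] by metis
  have KL: "KL \<rho> \<sigma> = ext_integral \<rho> (\<lambda>x. ln (f x))"
    by (rule KL_density_eq[OF \<sigma>.sigma_finite_measure_axioms f f0 \<rho>])
  have "(\<lambda>x. ln (f x)) \<in> borel_measurable \<rho>" unfolding \<rho> by measurable
  then have int: "integrable \<rho> (\<lambda>x. ln (f x))"
    by (rule integrable_of_ext_integral_finite)
      (use nn_integral_neg_ln_density_le[OF assms(1) f f0 \<rho>] assms(4) KL in \<open>auto simp: top_unique\<close>)
  define K where "K = (\<integral>x. ln (f x) \<partial>\<rho>)"
  have int': "integrable \<sigma> (\<lambda>x. f x * ln (f x))"
    using int f0 unfolding \<rho> by (subst (asm) integrable_density) auto
  have K: "K = (\<integral>x. f x * ln (f x) \<partial>\<sigma>)"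
    unfolding K_def \<rho> using f0 by (subst integral_density) auto
  have intf: "integrable \<sigma> f"
    using \<rho>.integrable_const[of "1::real"] f0 unfolding \<rho> by (subst (asm) integrable_density) auto
  have f1: "(\<integral>x. f x \<partial>\<sigma>) = 1"
  proof -
    have "1 = (\<integral>x. (1::real) \<partial>\<rho>)" by (simp add: \<rho>.prob_space)
    also have "\<dots> = (\<integral>x. f x \<partial>\<sigma>)"
      unfolding \<rho> using f0 by (subst integral_density) auto
    finally show ?thesis by simp
  qed
  have "\<bar>measure \<rho> E - measure \<sigma> E\<bar> \<le> K / (2 * t) + 2 * t"
    if [measurable]: "E \<in> sets \<sigma>" and t: "0 < t" for E t
  proof -
    have "measure \<rho> E = (\<integral>x. indicator E x \<partial>\<rho>)" using that assms(3) by simp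
    also have "\<dots> = (\<integral>x. f x * indicator E x \<partial>\<sigma>)"
      unfolding \<rho> using f0 by (subst integral_density) auto
    finally have mE: "measure \<rho> E = (\<integral>x. f x * indicator E x \<partial>\<sigma>)" .
    have iE: "integrable \<sigma> (\<lambda>x. f x * indicator E x)"
      by (rule integrable_mult_indicator[OF that(1) intf, simplified, unfolded mult.commute[of "indicator E _"]])
    have iE': "integrable \<sigma> (indicator E :: _ \<Rightarrow> real)"
      by (rule integrable_real_indicator) (auto simp: \<sigma>.emeasure_eq_measure)
    have "measure \<rho> E - measure \<sigma> E = (\<integral>x. f x * indicator E x \<partial>\<sigma>) - (\<integral>x. indicator E x \<partial>\<sigma>)"
      using mE by simp
    also have "\<dots> = (\<integral>x. f x * indicator E x - indicator E x \<partial>\<sigma>)"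
      by (rule Bochner_Integration.integral_diff[symmetric])
        (use iE iE' in auto)
    also have "\<bar>\<dots>\<bar> \<le> (\<integral>x. \<bar>f x * indicator E x - indicator E x\<bar> \<partial>\<sigma>)"
      by (rule integral_abs_bound)
    also have "\<dots> \<le> (\<integral>x. (f x * ln (f x) - f x + 1) / (2 * t) + t * (f x + 1) \<partial>\<sigma>)"
    proof (rule integral_mono)
      show "integrable \<sigma> (\<lambda>x. \<bar>f x * indicator E x - indicator E x\<bar>)"
        using iE iE' by (intro integrable_abs Bochner_Integration.integrable_diff)
      show "integrable \<sigma> (\<lambda>x. (f x * ln (f x) - f x + 1) / (2 * t) + t * (f x + 1))"
        using int' intf by auto
      show "\<bar>f x * indicator E x - indicator E x\<bar>
          \<le> (f x * ln (f x) - f x + 1) / (2 * t) + t * (f x + 1)" for x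
        using order_trans[OF abs_ge_zero abs_diff_one_le_entropy[OF f0 t]]
          abs_diff_one_le_entropy[OF f0 t] by (cases "x \<in> E") auto
    qed
    also have "\<dots> = K / (2 * t) + 2 * t"
      using int' intf f1 by (simp add: K \<sigma>.prob_space)
    finally show ?thesis .
  qed
  moreover have "KL \<rho> \<sigma> = ereal K" unfolding KL K_def by (rule ext_integral_eq_integral[OF int])
  ultimately show thesis using that by blast
qed

lemma KL_nonneg:
  assumes "prob_space \<sigma>" "prob_space \<rho>" "sets \<rho> = sets \<sigma>"
  shows "0 \<le> KL \<rho> \<sigma>"
proof (cases "KL \<rho> \<sigma> = \<infinity>")
  case False
  then obtain K where K: "KL \<rho> \<sigma> = ereal K"
    "\<And>E t. E \<in> sets \<sigma> \<Longrightarrow> 0 < t \<Longrightarrow> \<bar>measure \<rho> E - measure \<sigma> E\<bar> \<le> K / (2 * t) + 2 * t"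
    using KL_finite_obtain_measure_diff_bound[OF assms] by metis
  have "- K \<le> 0 + e" if "0 < e" for e
  proof -
    have "0 \<le> K / (2 * (sqrt e / 2)) + 2 * (sqrt e / 2)"
      using K(2)[of "{}" "sqrt e / 2"] that by simp
    then have "0 \<le> (K / sqrt e + sqrt e) * sqrt e" using that by simp
    also have "\<dots> = K + e" using that by (simp add: field_simps)
    finally show ?thesis by simp
  qed
  then have "- K \<le> 0" by (rule field_le_epsilon)
  with K(1) show ?thesis by simp
qed simp

lemma measure_diff_le_sqrt_KL:
  assumes "prob_space \<sigma>" "prob_space \<rho>" "sets \<rho> = sets \<sigma>" "KL \<rho> \<sigma> \<noteq> \<infinity>" "E \<in> sets \<sigma>"
  shows "\<bar>measure \<rho> E - measure \<sigma> E\<bar> \<le> 2 * sqrt (real_of_ereal (KL \<rho> \<sigma>))"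
proof -
  obtain K where K: "KL \<rho> \<sigma> = ereal K"
    "\<And>t. 0 < t \<Longrightarrow> \<bar>measure \<rho> E - measure \<sigma> E\<bar> \<le> K / (2 * t) + 2 * t"
    using KL_finite_obtain_measure_diff_bound[OF assms(1-4)] assms(5) by metis
  have "0 \<le> K" using KL_nonneg[OF assms(1-3)] K(1) by simp
  show ?thesis
  proof (cases "K = 0")
    case True
    have "\<bar>measure \<rho> E - measure \<sigma> E\<bar> \<le> 0 + e" if "0 < e" for e
      using K(2)[of "e / 2"] that True by simp
    then have "\<bar>measure \<rho> E - measure \<sigma> E\<bar> \<le> 0" by (rule field_le_epsilon)
    with K(1) True show ?thesis by simp
  next
    case False
    with \<open>0 \<le> K\<close> have "0 < K" by simp
    with K(2)[of "sqrt K / 2"] show ?thesis by (simp add: K(1) real_div_sqrt)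
  qed
qed

lemma KL_self:
  assumes "prob_space \<sigma>"
  shows "KL \<sigma> \<sigma> = 0"
proof -
  interpret prob_space \<sigma> by fact
  have "KL \<sigma> \<sigma> = ext_integral \<sigma> (\<lambda>x. ln 1)"
    by (rule KL_density_eq) (auto simp: sigma_finite_measure_axioms density_1)
  then show ?thesis by (simp add: ext_integral_def)
qed

lemma KL_le_0_iff:
  assumes "prob_space \<sigma>" "prob_space \<rho>" "sets \<rho> = sets \<sigma>"
  shows "KL \<rho> \<sigma> \<le> 0 \<longleftrightarrow> \<rho> = \<sigma>"
proof
  interpret \<sigma>: prob_space \<sigma> by fact
  interpret \<rho>: prob_space \<rho> by fact
  assume "KL \<rho> \<sigma> \<le> 0"
  with KL_nonneg[OF assms] have 0: "KL \<rho> \<sigma> = 0" by (rule antisym[rotated])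
  show "\<rho> = \<sigma>"
  proof (rule measure_eqI)
    fix E assume "E \<in> sets \<rho>"
    then have "measure \<rho> E = measure \<sigma> E"
      using measure_diff_le_sqrt_KL[OF assms, of E] 0 assms(3) by simp
    then show "emeasure \<rho> E = emeasure \<sigma> E"
      by (simp add: \<sigma>.emeasure_eq_measure \<rho>.emeasure_eq_measure)
  qed fact
next
  assume "\<rho> = \<sigma>"
  with KL_self[OF assms(1)] show "KL \<rho> \<sigma> \<le> 0" by simp
qed

lemma integral_pos_of_AE_pos:
  assumes "prob_space \<mu>" "integrable \<mu> f" "AE x in \<mu>. (0::real) < f x"
  shows "0 < (\<integral>x. f x \<partial>\<mu>)"
proof -
  interpret prob_space \<mu> by fact
  have "\<not> (AE x in \<mu>. f x = 0)"
  proof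
    assume "AE x in \<mu>. f x = 0"
    with assms(3) have "AE x in \<mu>. False" by eventually_elim simp
    then show False by simp
  qed
  moreover have nn: "AE x in \<mu>. 0 \<le> f x" using assms(3) by eventually_elim simp
  ultimately have "(\<integral>x. f x \<partial>\<mu>) \<noteq> 0" using integral_nonneg_eq_0_iff_AE[OF assms(2)] by blast
  with integral_nonneg_AE[OF nn] show ?thesis by simp
qed

lemma tilt_eq_density:
  assumes "prob_space \<mu>" and int: "integrable \<mu> f" and pos: "AE x in \<mu>. 0 < f x"
  shows "tilt \<mu> f = density \<mu> (\<lambda>x. ennreal (f x / (\<integral>x. f x \<partial>\<mu>)))"
proof -
  have [measurable]: "f \<in> borel_measurable \<mu>" using int by auto
  have Z: "0 < (\<integral>x. f x \<partial>\<mu>)" by (rule integral_pos_of_AE_pos[OF assms])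
  have nn: "AE x in \<mu>. 0 \<le> f x" using pos by eventually_elim simp
  have "(\<integral>\<^sup>+x. ennreal (f x) \<partial>\<mu>) = ennreal (\<integral>x. f x \<partial>\<mu>)"
    by (rule nn_integral_eq_integral[OF int nn])
  then show ?thesis unfolding tilt_def
    by (intro density_cong) (use nn Z in \<open>auto simp: divide_ennreal\<close>)
qed

lemma measure_tilt:
  assumes "prob_space \<mu>" and int: "integrable \<mu> f" and pos: "AE x in \<mu>. 0 < f x"
    and [measurable]: "E \<in> sets \<mu>"
  shows "measure (tilt \<mu> f) E = (\<integral>x\<in>E. f x \<partial>\<mu>) / (\<integral>x. f x \<partial>\<mu>)"
proof -
  have [measurable]: "f \<in> borel_measurable \<mu>" using int by auto
  have Z: "0 < (\<integral>x. f x \<partial>\<mu>)" by (rule integral_pos_of_AE_pos[OF assms(1-3)])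
  have nn: "AE x in \<mu>. 0 \<le> f x / (\<integral>x. f x \<partial>\<mu>)" using pos by eventually_elim (use Z in simp)
  have "measure (tilt \<mu> f) E = (\<integral>x. indicator E x \<partial>tilt \<mu> f)" by (simp add: tilt_def)
  also have "\<dots> = (\<integral>x. f x / (\<integral>x. f x \<partial>\<mu>) * indicator E x \<partial>\<mu>)"
    unfolding tilt_eq_density[OF assms(1-3)] using nn by (subst integral_density) auto
  also have "\<dots> = (\<integral>x\<in>E. f x \<partial>\<mu>) / (\<integral>x. f x \<partial>\<mu>)"
    by (simp add: set_lebesgue_integral_def mult.commute)
  finally show ?thesis .
qed

lemma sets_tilt [simp]: "sets (tilt \<mu> f) = sets \<mu>"
  by (simp add: tilt_def)

lemma prob_space_tilt:
  assumes "prob_space \<mu>" and int: "integrable \<mu> f" and pos: "AE x in \<mu>. 0 < f x"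
  shows "prob_space (tilt \<mu> f)"
proof
  have [measurable]: "f \<in> borel_measurable \<mu>" using int by auto
  have Z: "0 < (\<integral>x. f x \<partial>\<mu>)" by (rule integral_pos_of_AE_pos[OF assms])
  have "(\<integral>\<^sup>+x. ennreal (f x) \<partial>\<mu>) = ennreal (\<integral>x. f x \<partial>\<mu>)"
    by (rule nn_integral_eq_integral[OF int]) (use pos in \<open>eventually_elim, simp\<close>)
  moreover have "(\<integral>\<^sup>+x\<in>space \<mu>. ennreal (f x) \<partial>\<mu>) = (\<integral>\<^sup>+x. ennreal (f x) \<partial>\<mu>)"
    by (rule nn_integral_cong) auto
  moreover have "space (tilt \<mu> f) = space \<mu>" by (simp add: tilt_def)
  ultimately show "emeasure (tilt \<mu> f) (space (tilt \<mu> f)) = 1"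
    using Z by (simp add: emeasure_tilt divide_ennreal)
qed

lemma abs_cont_tilt_iff:
  assumes "prob_space \<mu>" and int: "integrable \<mu> f" and pos: "AE x in \<mu>. 0 < f x"
  shows "absolutely_continuous (tilt \<mu> f) \<rho> \<longleftrightarrow> absolutely_continuous \<mu> \<rho>"
proof -
  have [measurable]: "f \<in> borel_measurable \<mu>" using int by auto
  have Z: "0 < (\<integral>x. f x \<partial>\<mu>)" by (rule integral_pos_of_AE_pos[OF assms])
  have pos': "AE x in \<mu>. 0 < ennreal (f x / (\<integral>x. f x \<partial>\<mu>))"
    using pos by eventually_elim (use Z in simp)
  have "E \<in> null_sets (tilt \<mu> f) \<longleftrightarrow> E \<in> null_sets \<mu>" for E
  proof (cases "E \<in> sets \<mu>")
    case True
    have "E \<in> null_sets (tilt \<mu> f) \<longleftrightarrow> (AE x in \<mu>. x \<in> E \<longrightarrow> ennreal (f x / (\<integral>x. f x \<partial>\<mu>)) = 0)"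
      unfolding tilt_eq_density[OF assms] using True by (subst null_sets_density_iff) auto
    also have "\<dots> \<longleftrightarrow> (AE x in \<mu>. x \<notin> E)"
      by (rule eventually_subst) (use pos' in \<open>eventually_elim, auto\<close>)
    also have "\<dots> \<longleftrightarrow> E \<in> null_sets \<mu>" using True AE_iff_null_sets by blast
    finally show ?thesis .
  qed (auto simp: null_sets_def)
  then show ?thesis unfolding absolutely_continuous_def by blast
qed

text \<open>Only an upper bound on the weight is available, so \<open>ln (w / k)\<close> may have infinite negative part under
  \<open>\<rho>\<close>; the identity holds in the extended reals because \<open>- ln (w / k)\<close> and the log-density of \<open>\<rho>\<close> both have
  finite negative part.\<close>
lemma F_tilde_eq_KL:
  assumes "prob_space \<mu>" "prob_space \<rho>" "sets \<rho> = sets \<mu>" "0 < k"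
    and w[measurable]: "w \<in> borel_measurable \<mu>" and AEw: "AE x in \<mu>. 0 < w x \<and> w x \<le> C"
  shows "F_tilde \<mu> k w \<rho> = ereal (- ln (\<integral>x. 1 / k * w x \<partial>\<mu>)) + KL \<rho> (tilt \<mu> w)"
proof -
  interpret \<mu>: prob_space \<mu> by fact
  interpret \<rho>: prob_space \<rho> by fact
  have int: "integrable \<mu> w"
    by (rule \<mu>.integrable_const_bound[of _ C]) (use AEw in auto)
  have pos: "AE x in \<mu>. 0 < w x" using AEw by eventually_elim simp
  note tilt = \<open>prob_space \<mu>\<close> int pos
  have Z: "0 < (\<integral>x. w x \<partial>\<mu>)" by (rule integral_pos_of_AE_pos[OF tilt])
  show ?thesis
  proof (cases "absolutely_continuous \<mu> \<rho>")
    case False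
    then show ?thesis by (simp add: F_tilde_def KL_def abs_cont_tilt_iff[OF tilt])
  next
    case ac: True
    obtain f where f[measurable]: "f \<in> borel_measurable \<mu>" and f0: "\<And>x. 0 \<le> f x"
      and fpos: "AE x in \<rho>. 0 < f x" and \<rho>: "\<rho> = density \<mu> (\<lambda>x. ennreal (f x))"
      using abs_cont_prob_density[OF assms(1-3) ac] by metis
    define h where "h x = (if 0 < w x then w x / (\<integral>x. w x \<partial>\<mu>) else 1)" for x
    have h[measurable]: "h \<in> borel_measurable \<mu>" unfolding h_def by measurable
    have h0: "0 < h x" for x using Z by (simp add: h_def)
    have "tilt \<mu> w = density \<mu> (\<lambda>x. ennreal (h x))"
      unfolding tilt_eq_density[OF tilt] by (rule density_cong) (use pos in \<open>auto simp: h_def\<close>)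
    then have "density (tilt \<mu> w) (\<lambda>x. ennreal (f x / h x)) =
        density \<mu> (\<lambda>x. ennreal (h x) * ennreal (f x / h x))"
      by (simp add: density_density_eq)
    also have "\<dots> = \<rho>" unfolding \<rho>
      by (rule density_cong) (use h0 f0 in \<open>auto simp: ennreal_mult'[symmetric] less_imp_le less_imp_neq[symmetric]\<close>)
    finally have \<rho>': "\<rho> = density (tilt \<mu> w) (\<lambda>x. ennreal (f x / h x))" ..
    have AE\<rho>: "AE x in \<rho>. 0 < w x \<and> w x \<le> C"
      by (rule absolutely_continuous_AE[OF _ ac AEw]) (simp add: assms)
    let ?W = "\<integral>x. 1 / k * w x \<partial>\<mu>"
    have W: "?W = (\<integral>x. w x \<partial>\<mu>) / k" by simp
    have meas\<rho>[measurable]: "f \<in> borel_measurable \<rho>" "w \<in> borel_measurable \<rho>"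
      unfolding \<rho> by measurable
    interpret t: prob_space "tilt \<mu> w" by (rule prob_space_tilt[OF tilt])
    have "KL \<rho> (tilt \<mu> w) = ext_integral \<rho> (\<lambda>x. ln (f x / h x))"
    proof (rule KL_density_eq[OF t.sigma_finite_measure_axioms _ _ \<rho>'])
      show "(\<lambda>x. f x / h x) \<in> borel_measurable (tilt \<mu> w)" unfolding tilt_def by measurable
    qed (use f0 h0 in \<open>auto simp: less_imp_le\<close>)
    also have "\<dots> = ext_integral \<rho> (\<lambda>x. ln (f x) + (ln ?W + - ln (1 / k * w x)))"
    proof (rule ext_integral_cong_AE)
      show "AE x in \<rho>. ln (f x / h x) = ln (f x) + (ln ?W + - ln (1 / k * w x))"
        using fpos AE\<rho>
      proof eventually_elim
        case (elim x)
        then show ?case using Z \<open>0 < k\<close> unfolding W h_def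
          by (simp add: ln_div ln_mult)
      qed
    qed
    also have "\<dots> = KL \<rho> \<mu> + (ereal (ln ?W) + - ext_integral \<rho> (\<lambda>x. ln (1 / k * w x)))"
    proof -
      have neg1: "(\<integral>\<^sup>+x. ennreal (- ln (f x)) \<partial>\<rho>) \<noteq> \<infinity>"
        using nn_integral_neg_ln_density_le[OF assms(1) f f0 \<rho>] by (auto simp: top_unique)
      have "(\<integral>\<^sup>+x. ennreal (ln (1 / k * w x)) \<partial>\<rho>) \<le> (\<integral>\<^sup>+x. ennreal \<bar>ln (C / k)\<bar> \<partial>\<rho>)"
      proof (rule nn_integral_mono_AE)
        show "AE x in \<rho>. ennreal (ln (1 / k * w x)) \<le> ennreal \<bar>ln (C / k)\<bar>"
          using AE\<rho>
        proof eventually_elim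
          case (elim x)
          with \<open>0 < k\<close> have "ln (1 / k * w x) \<le> ln (C / k)" by (simp add: divide_right_mono)
          then show ?case by (intro ennreal_leI) simp
        qed
      qed
      then have neg2: "(\<integral>\<^sup>+x. ennreal (- (- ln (1 / k * w x))) \<partial>\<rho>) \<noteq> \<infinity>"
        by (auto simp: \<rho>.emeasure_space_1 top_unique)
      have neg3: "(\<integral>\<^sup>+x. ennreal (- ln ?W) \<partial>\<rho>) \<noteq> \<infinity>" by (simp add: \<rho>.emeasure_space_1)
      have "(\<integral>\<^sup>+x. ennreal (- (ln ?W + - ln (1 / k * w x))) \<partial>\<rho>) \<noteq> \<infinity>"
        by (rule nn_integral_neg_add_finite[OF _ _ neg3 neg2]) measurable
      then have "ext_integral \<rho> (\<lambda>x. ln (f x) + (ln ?W + - ln (1 / k * w x))) =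
          ext_integral \<rho> (\<lambda>x. ln (f x)) + ext_integral \<rho> (\<lambda>x. ln ?W + - ln (1 / k * w x))"
        by (intro ext_integral_add neg1) measurable
      also have "ext_integral \<rho> (\<lambda>x. ln ?W + - ln (1 / k * w x)) =
          ext_integral \<rho> (\<lambda>x. ln ?W) + ext_integral \<rho> (\<lambda>x. - ln (1 / k * w x))"
        by (rule ext_integral_add[OF _ _ neg3 neg2]) measurable
      also have "ext_integral \<rho> (\<lambda>x. ln ?W) = ereal (ln ?W)"
        by (subst ext_integral_eq_integral) (auto simp: \<rho>.prob_space)
      also have "ext_integral \<rho> (\<lambda>x. - ln (1 / k * w x)) = - ext_integral \<rho> (\<lambda>x. ln (1 / k * w x))"
        using ext_integral_uminus[OF neg2] by (simp only: minus_minus ereal_uminus_uminus)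
      finally show ?thesis
        by (simp only: KL_density_eq[OF \<mu>.sigma_finite_measure_axioms f f0 \<rho>])
    qed
    finally have KL: "KL \<rho> (tilt \<mu> w) = KL \<rho> \<mu> + (ereal (ln ?W) + - ext_integral \<rho> (\<lambda>x. ln (1 / k * w x)))" .
    show ?thesis using ac unfolding F_tilde_def KL
      by (cases "KL \<rho> \<mu>"; cases "ext_integral \<rho> (\<lambda>x. ln (1 / k * w x))") auto
  qed
qed

lemma unique_minimizer_KL:
  assumes \<sigma>: "\<sigma> \<in> prob_measures B"
    and F: "\<And>\<rho>. \<rho> \<in> prob_measures B \<Longrightarrow> F \<rho> = ereal c + KL \<rho> \<sigma>"
  shows "unique_minimizer F (prob_measures B) \<sigma> \<and> (INF \<rho>\<in>prob_measures B. F \<rho>) = F \<sigma> \<and>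
    F \<sigma> = ereal c"
proof -
  have F\<sigma>: "F \<sigma> = ereal c" using F[OF \<sigma>] \<sigma> by (simp add: KL_self space_prob_algebra)
  have ge: "ereal c \<le> F \<rho>" if "\<rho> \<in> prob_measures B" for \<rho>
  proof -
    have "0 \<le> KL \<rho> \<sigma>" using \<sigma> that by (intro KL_nonneg) (auto simp: space_prob_algebra)
    then show ?thesis using F[OF that] by (cases "KL \<rho> \<sigma>") auto
  qed
  have eq: "\<rho> = \<sigma>" if "\<rho> \<in> prob_measures B" "F \<rho> \<le> ereal c" for \<rho>
  proof -
    have "KL \<rho> \<sigma> \<le> 0" using F[OF that(1)] that(2) by (cases "KL \<rho> \<sigma>") auto
    then show ?thesis using \<sigma> that(1) by (subst (asm) KL_le_0_iff) (auto simp: space_prob_algebra)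
  qed
  have "is_arg_min F (\<lambda>z. z \<in> prob_measures B) y \<longleftrightarrow> y = \<sigma>" for y
    using F\<sigma> ge eq \<sigma> unfolding is_arg_min_def by (metis not_le)
  moreover have "(INF \<rho>\<in>prob_measures B. F \<rho>) = F \<sigma>"
    using \<sigma> ge F\<sigma> by (intro antisym INF_lower INF_greatest) auto
  ultimately show ?thesis using F\<sigma> by (simp add: unique_minimizer_def)
qed

lemma tilt_scale:
  assumes "prob_space \<mu>" "integrable \<mu> f" "AE x in \<mu>. 0 < f x" "0 < c"
  shows "tilt \<mu> (\<lambda>x. c * f x) = tilt \<mu> f"
proof -
  have "AE x in \<mu>. 0 < c * f x" using assms(3) by eventually_elim (use assms(4) in simp)
  with assms show ?thesis by (subst (1 2) tilt_eq_density) auto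
qed

lemma measure_tilt_diff_le:
  assumes "prob_space \<mu>" and f: "integrable \<mu> f" "AE x in \<mu>. 0 < f x"
    and g: "integrable \<mu> g" "AE x in \<mu>. 0 < g x" and E: "E \<in> sets \<mu>"
  shows "\<bar>measure (tilt \<mu> f) E - measure (tilt \<mu> g) E\<bar>
    \<le> 2 * (\<integral>x. \<bar>f x - g x\<bar> \<partial>\<mu>) / (\<integral>x. f x \<partial>\<mu>)"
proof -
  define \<delta> where "\<delta> = (\<integral>x. \<bar>f x - g x\<bar> \<partial>\<mu>)"
  define a b Za Zb where "a = (\<integral>x\<in>E. f x \<partial>\<mu>)" and "b = (\<integral>x\<in>E. g x \<partial>\<mu>)"
    and "Za = (\<integral>x. f x \<partial>\<mu>)" and "Zb = (\<integral>x. g x \<partial>\<mu>)"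
  note defs = \<delta>_def a_def b_def Za_def Zb_def
  have Z: "0 < Za" "0 < Zb"
    using integral_pos_of_AE_pos[OF assms(1)] f g by (auto simp: defs)
  have int: "integrable \<mu> (\<lambda>x. indicator E x * f x)" "integrable \<mu> (\<lambda>x. indicator E x * g x)"
    using integrable_mult_indicator[OF E f(1)] integrable_mult_indicator[OF E g(1)] by auto
  have "\<bar>a - b\<bar> = \<bar>\<integral>x. indicator E x * f x - indicator E x * g x \<partial>\<mu>\<bar>"
    using int by (simp add: defs set_lebesgue_integral_def)
  also have "\<dots> \<le> (\<integral>x. \<bar>indicator E x * f x - indicator E x * g x\<bar> \<partial>\<mu>)"
    by (rule integral_abs_bound)
  also have "\<dots> \<le> \<delta>" unfolding \<delta>_def
    by (rule integral_mono) (use int f g in \<open>auto split: split_indicator\<close>)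
  finally have ab: "\<bar>a - b\<bar> \<le> \<delta>" .
  have "\<bar>Za - Zb\<bar> = \<bar>\<integral>x. f x - g x \<partial>\<mu>\<bar>" using f g by (simp add: defs)
  also have "\<dots> \<le> \<delta>" unfolding \<delta>_def by (rule integral_abs_bound)
  finally have ZZ: "\<bar>Za - Zb\<bar> \<le> \<delta>" .
  have "0 \<le> b" unfolding b_def set_lebesgue_integral_def
    by (rule integral_nonneg_AE) (use g(2) in \<open>eventually_elim, auto\<close>)
  have "b \<le> Zb" unfolding defs set_lebesgue_integral_def
    by (rule integral_mono_AE) (use g int in \<open>auto split: split_indicator\<close>)
  have "\<bar>a / Za - b / Zb\<bar> = \<bar>(a - b) * Zb + b * (Zb - Za)\<bar> / (Za * Zb)"
    using Z by (simp add: diff_frac_eq abs_divide algebra_simps)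
  also have "\<dots> \<le> (\<delta> * Zb + Zb * \<delta>) / (Za * Zb)"
  proof (rule divide_right_mono)
    have "\<bar>(a - b) * Zb + b * (Zb - Za)\<bar> \<le> \<bar>a - b\<bar> * Zb + b * \<bar>Za - Zb\<bar>"
      using abs_triangle_ineq[of "(a - b) * Zb" "b * (Zb - Za)"] Z \<open>0 \<le> b\<close>
      by (simp add: abs_mult abs_minus_commute)
    also have "\<dots> \<le> \<delta> * Zb + Zb * \<delta>"
      using ab ZZ Z \<open>0 \<le> b\<close> \<open>b \<le> Zb\<close> by (intro add_mono mult_mono) auto
    finally show "\<bar>(a - b) * Zb + b * (Zb - Za)\<bar> \<le> \<delta> * Zb + Zb * \<delta>" .
  qed (use Z in simp)
  also have "\<dots> = 2 * \<delta> / Za" using Z by (simp add: field_simps)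
  finally show ?thesis unfolding defs using measure_tilt[OF assms(1)] f g E by simp
qed

theorem theorem4p1:
  fixes \<Theta> :: "(real ^ 'm) set"
    and d :: "real ^ 'm \<Rightarrow> real ^ 'm \<Rightarrow> real"
    and B :: "(real ^ 'm) measure"
    and prior :: "(real ^ 'm) measure"
    and w :: "real \<Rightarrow> real ^ 'm \<Rightarrow> real"
    and \<kappa> :: "real \<Rightarrow> real"
    and wbar :: "real ^ 'm \<Rightarrow> real"
  assumes "Metric_space \<Theta> d"
    and "B = borel_metric \<Theta> d"
    and "prior \<in> prob_measures B"
    and "\<And>\<epsilon>. \<epsilon> > 0 \<Longrightarrow> w \<epsilon> \<in> borel_measurable B"
    and "\<And>\<epsilon> \<theta>. \<epsilon> > 0 \<Longrightarrow> \<theta> \<in> \<Theta> \<Longrightarrow> 0 \<le> w \<epsilon> \<theta>"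
    and "\<And>\<epsilon>. \<epsilon> > 0 \<Longrightarrow> AE \<theta> in prior. 0 < w \<epsilon> \<theta> \<and> w \<epsilon> \<theta> \<le> 1"
    and "\<And>\<epsilon>. \<epsilon> > 0 \<Longrightarrow> 0 < \<kappa> \<epsilon>"
    and "wbar \<in> borel_measurable B"
    and "\<And>\<theta>. \<theta> \<in> \<Theta> \<Longrightarrow> 0 \<le> wbar \<theta>"
    and "integrable prior wbar"
    and "\<not> (AE \<theta> in prior. wbar \<theta> = 0)"
    and "((\<lambda>\<epsilon>. \<integral>\<theta>. \<bar>1 / \<kappa> \<epsilon> * w \<epsilon> \<theta> - wbar \<theta>\<bar> \<partial>prior) \<longlongrightarrow> 0) (at_right 0)"
    and "AE \<theta> in prior. 0 < wbar \<theta>"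
  shows
    "(\<forall>\<epsilon>>0.
        unique_minimizer (F_tilde prior (\<kappa> \<epsilon>) (w \<epsilon>)) (prob_measures B) (tilt prior (w \<epsilon>)) \<and>
        (INF \<rho>\<in>prob_measures B. F_tilde prior (\<kappa> \<epsilon>) (w \<epsilon>) \<rho>) =
          F_tilde prior (\<kappa> \<epsilon>) (w \<epsilon>) (tilt prior (w \<epsilon>)) \<and>
        F_tilde prior (\<kappa> \<epsilon>) (w \<epsilon>) (tilt prior (w \<epsilon>)) =
          ereal (- ln (\<integral>\<theta>. 1 / \<kappa> \<epsilon> * w \<epsilon> \<theta> \<partial>prior))) \<and>
     (unique_minimizer (F_bar prior wbar) (prob_measures B) (tilt prior wbar) \<and>
        (INF \<rho>\<in>prob_measures B. F_bar prior wbar \<rho>) = F_bar prior wbar (tilt prior wbar) \<and>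
        F_bar prior wbar (tilt prior wbar) = ereal (- ln (\<integral>\<theta>. wbar \<theta> \<partial>prior))) \<and>
     ((\<lambda>\<epsilon>. F_tilde prior (\<kappa> \<epsilon>) (w \<epsilon>) (tilt prior (w \<epsilon>)))
        \<longlongrightarrow> F_bar prior wbar (tilt prior wbar)) (at_right 0) \<and>
     (\<forall>\<rho>. (\<forall>\<epsilon>>0. \<rho> \<epsilon> \<in> prob_measures B) \<longrightarrow>
        ((\<lambda>\<epsilon>. F_tilde prior (\<kappa> \<epsilon>) (w \<epsilon>) (\<rho> \<epsilon>) -
               F_tilde prior (\<kappa> \<epsilon>) (w \<epsilon>) (tilt prior (w \<epsilon>))) \<longlongrightarrow> 0) (at_right 0) \<longrightarrow>
        ((\<lambda>\<epsilon>. SUP E\<in>sets B. \<bar>measure (\<rho> \<epsilon>) E - measure (tilt prior wbar) E\<bar>)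
           \<longlongrightarrow> 0) (at_right 0))"
proof -
  note w_meas = assms(4) and w_AE = assms(6) and \<kappa> = assms(7) and wbar = assms(10,13)
  have sets: "sets prior = sets B" and prob: "prob_space prior"
    using assms(3) by (auto simp: space_prob_algebra)
  interpret prob_space prior by fact
  define W where "W \<epsilon> \<theta> = 1 / \<kappa> \<epsilon> * w \<epsilon> \<theta>" for \<epsilon> \<theta>
  define \<delta> where "\<delta> \<epsilon> = (\<integral>\<theta>. \<bar>W \<epsilon> \<theta> - wbar \<theta>\<bar> \<partial>prior)" for \<epsilon>
  define Z Zbar where "Z \<epsilon> = (\<integral>\<theta>. W \<epsilon> \<theta> \<partial>prior)" and "Zbar = (\<integral>\<theta>. wbar \<theta> \<partial>prior)" for \<epsilon>
  have w: "w \<epsilon> \<in> borel_measurable prior" "integrable prior (w \<epsilon>)" "AE \<theta> in prior. 0 < w \<epsilon> \<theta>"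
    if "0 < \<epsilon>" for \<epsilon>
  proof -
    show m: "w \<epsilon> \<in> borel_measurable prior"
      using w_meas[OF that] by (simp cong: measurable_cong_sets add: sets)
    show "AE \<theta> in prior. 0 < w \<epsilon> \<theta>" using w_AE[OF that] by eventually_elim simp
    show "integrable prior (w \<epsilon>)"
      by (rule integrable_const_bound[of _ 1, OF _ m]) (use w_AE[OF that] in \<open>eventually_elim, auto\<close>)
  qed
  have W: "integrable prior (W \<epsilon>)" "AE \<theta> in prior. 0 < W \<epsilon> \<theta>" "tilt prior (W \<epsilon>) = tilt prior (w \<epsilon>)"
    if "0 < \<epsilon>" for \<epsilon>
  proof -
    show "integrable prior (W \<epsilon>)" unfolding W_def using w(2)[OF that] by simp
    show "AE \<theta> in prior. 0 < W \<epsilon> \<theta>"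
      using w(3)[OF that] by eventually_elim (use \<kappa>[OF that] in \<open>simp add: W_def\<close>)
    show "tilt prior (W \<epsilon>) = tilt prior (w \<epsilon>)"
      unfolding W_def by (rule tilt_scale[OF prob w(2,3)[OF that]]) (use \<kappa>[OF that] in simp)
  qed
  have pm: "\<rho> \<in> prob_measures B \<longleftrightarrow> prob_space \<rho> \<and> sets \<rho> = sets prior" for \<rho>
    by (auto simp: space_prob_algebra sets)
  have tilt_w: "tilt prior (w \<epsilon>) \<in> prob_measures B" if "0 < \<epsilon>" for \<epsilon>
    using prob_space_tilt[OF prob w(2,3)[OF that]] by (simp add: pm)
  have tilt_bar: "tilt prior wbar \<in> prob_measures B"
    using prob_space_tilt[OF prob wbar] by (simp add: pm)
  have F: "F_tilde prior (\<kappa> \<epsilon>) (w \<epsilon>) \<rho> = ereal (- ln (Z \<epsilon>)) + KL \<rho> (tilt prior (w \<epsilon>))"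
    if "0 < \<epsilon>" "\<rho> \<in> prob_measures B" for \<epsilon> \<rho>
    unfolding Z_def W_def
    by (rule F_tilde_eq_KL[OF prob _ _ \<kappa>[OF that(1)] w(1)[OF that(1)] w_AE[OF that(1)]])
      (use that(2) in \<open>auto simp: pm\<close>)
  have i: "unique_minimizer (F_tilde prior (\<kappa> \<epsilon>) (w \<epsilon>)) (prob_measures B) (tilt prior (w \<epsilon>)) \<and>
      (INF \<rho>\<in>prob_measures B. F_tilde prior (\<kappa> \<epsilon>) (w \<epsilon>) \<rho>) =
        F_tilde prior (\<kappa> \<epsilon>) (w \<epsilon>) (tilt prior (w \<epsilon>)) \<and>
      F_tilde prior (\<kappa> \<epsilon>) (w \<epsilon>) (tilt prior (w \<epsilon>)) = ereal (- ln (Z \<epsilon>))" if "0 < \<epsilon>" for \<epsilon>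
    by (rule unique_minimizer_KL[OF tilt_w[OF that] F[OF that]])
  have ii: "unique_minimizer (F_bar prior wbar) (prob_measures B) (tilt prior wbar) \<and>
      (INF \<rho>\<in>prob_measures B. F_bar prior wbar \<rho>) = F_bar prior wbar (tilt prior wbar) \<and>
      F_bar prior wbar (tilt prior wbar) = ereal (- ln Zbar)"
    by (rule unique_minimizer_KL[OF tilt_bar]) (simp add: F_bar_def Zbar_def)
  have pos: "\<forall>\<^sub>F \<epsilon> in at_right (0::real). 0 < \<epsilon>" by (rule eventually_at_right_less)
  have \<delta>: "(\<delta> \<longlongrightarrow> 0) (at_right 0)" unfolding \<delta>_def W_def by (fact assms(12))
  have "((\<lambda>\<epsilon>. Z \<epsilon> - Zbar) \<longlongrightarrow> 0) (at_right 0)"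
  proof (rule Lim_null_comparison[OF _ \<delta>])
    show "\<forall>\<^sub>F \<epsilon> in at_right 0. norm (Z \<epsilon> - Zbar) \<le> \<delta> \<epsilon>"
      using pos
    proof eventually_elim
      case (elim \<epsilon>)
      have "Z \<epsilon> - Zbar = (\<integral>\<theta>. W \<epsilon> \<theta> - wbar \<theta> \<partial>prior)"
        unfolding Z_def Zbar_def using W(1)[OF elim] wbar(1) by simp
      then show ?case unfolding \<delta>_def by (simp add: integral_abs_bound)
    qed
  qed
  then have Z: "(Z \<longlongrightarrow> Zbar) (at_right 0)" by (rule LIM_zero_cancel)
  have Zbar: "0 < Zbar" unfolding Zbar_def by (rule integral_pos_of_AE_pos[OF prob wbar])
  have "((\<lambda>\<epsilon>. ereal (- ln (Z \<epsilon>))) \<longlongrightarrow> ereal (- ln Zbar)) (at_right 0)"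
    using Z Zbar by (intro tendsto_intros) auto
  then have "((\<lambda>\<epsilon>. F_tilde prior (\<kappa> \<epsilon>) (w \<epsilon>) (tilt prior (w \<epsilon>))) \<longlongrightarrow> ereal (- ln Zbar)) (at_right 0)"
    by (rule Lim_transform_eventually) (rule eventually_mono[OF pos], simp add: i)
  with ii have iii: "((\<lambda>\<epsilon>. F_tilde prior (\<kappa> \<epsilon>) (w \<epsilon>) (tilt prior (w \<epsilon>)))
      \<longlongrightarrow> F_bar prior wbar (tilt prior wbar)) (at_right 0)" by simp
  have iv: "((\<lambda>\<epsilon>. SUP E\<in>sets B. \<bar>measure (\<rho> \<epsilon>) E - measure (tilt prior wbar) E\<bar>) \<longlongrightarrow> 0) (at_right 0)"
    if \<rho>: "\<forall>\<epsilon>>0. \<rho> \<epsilon> \<in> prob_measures B"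
      and lim: "((\<lambda>\<epsilon>. F_tilde prior (\<kappa> \<epsilon>) (w \<epsilon>) (\<rho> \<epsilon>) - F_tilde prior (\<kappa> \<epsilon>) (w \<epsilon>) (tilt prior (w \<epsilon>)))
        \<longlongrightarrow> 0) (at_right 0)" for \<rho>
  proof -
    define K where "K \<epsilon> = KL (\<rho> \<epsilon>) (tilt prior (w \<epsilon>))" for \<epsilon>
    have "\<forall>\<^sub>F \<epsilon> in at_right 0. F_tilde prior (\<kappa> \<epsilon>) (w \<epsilon>) (\<rho> \<epsilon>) -
        F_tilde prior (\<kappa> \<epsilon>) (w \<epsilon>) (tilt prior (w \<epsilon>)) = K \<epsilon>"
      using pos
    proof eventually_elim
      case (elim \<epsilon>)
      then show ?case using i[OF elim] F[OF elim] \<rho>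
        by (cases "K \<epsilon>") (auto simp: K_def)
    qed
    then have K: "(K \<longlongrightarrow> 0) (at_right 0)" by (rule Lim_transform_eventually[OF lim])
    then have K_fin: "\<forall>\<^sub>F \<epsilon> in at_right 0. K \<epsilon> < \<infinity>" by (rule order_tendstoD) simp
    have "((\<lambda>\<epsilon>. real_of_ereal (K \<epsilon>)) \<longlongrightarrow> 0) (at_right 0)"
      using lim_real_of_ereal[of K 0] K by (simp add: zero_ereal_def)
    then have "((\<lambda>\<epsilon>. 2 * sqrt (real_of_ereal (K \<epsilon>)) + 2 * \<delta> \<epsilon> / Z \<epsilon>)
        \<longlongrightarrow> 2 * sqrt 0 + 2 * 0 / Zbar) (at_right 0)"
      using \<delta> Z Zbar
      by (intro tendsto_add tendsto_mult tendsto_divide tendsto_real_sqrt tendsto_const) auto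
    then have bound: "((\<lambda>\<epsilon>. 2 * sqrt (real_of_ereal (K \<epsilon>)) + 2 * \<delta> \<epsilon> / Z \<epsilon>) \<longlongrightarrow> 0) (at_right 0)"
      by simp
    show ?thesis
    proof (rule Lim_null_comparison[OF _ bound])
      show "\<forall>\<^sub>F \<epsilon> in at_right 0. norm (SUP E\<in>sets B. \<bar>measure (\<rho> \<epsilon>) E - measure (tilt prior wbar) E\<bar>)
          \<le> 2 * sqrt (real_of_ereal (K \<epsilon>)) + 2 * \<delta> \<epsilon> / Z \<epsilon>"
        using pos K_fin
      proof eventually_elim
        case (elim \<epsilon>)
        have \<rho>\<epsilon>: "prob_space (\<rho> \<epsilon>)" "sets (\<rho> \<epsilon>) = sets (tilt prior (w \<epsilon>))"
          using \<rho> elim by (auto simp: pm)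
        have le: "\<bar>measure (\<rho> \<epsilon>) E - measure (tilt prior wbar) E\<bar>
            \<le> 2 * sqrt (real_of_ereal (K \<epsilon>)) + 2 * \<delta> \<epsilon> / Z \<epsilon>" if "E \<in> sets B" for E
        proof -
          have "\<bar>measure (\<rho> \<epsilon>) E - measure (tilt prior (w \<epsilon>)) E\<bar> \<le> 2 * sqrt (real_of_ereal (K \<epsilon>))"
            unfolding K_def
            by (rule measure_diff_le_sqrt_KL[OF _ \<rho>\<epsilon>])
              (use tilt_w elim that in \<open>auto simp: pm K_def sets\<close>)
          moreover have "\<bar>measure (tilt prior (W \<epsilon>)) E - measure (tilt prior wbar) E\<bar> \<le> 2 * \<delta> \<epsilon> / Z \<epsilon>"
            unfolding \<delta>_def Z_def
            by (rule measure_tilt_diff_le[OF prob W(1,2) wbar]) (use elim that in \<open>auto simp: sets\<close>)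
          ultimately show ?thesis using W(3) elim by simp
        qed
        have ne: "sets B \<noteq> {}" by auto
        have "0 \<le> \<bar>measure (\<rho> \<epsilon>) {} - measure (tilt prior wbar) {}\<bar>" by simp
        also have "\<dots> \<le> (SUP E\<in>sets B. \<bar>measure (\<rho> \<epsilon>) E - measure (tilt prior wbar) E\<bar>)"
          by (rule cSUP_upper) (use le in \<open>auto intro!: bdd_aboveI2\<close>)
        finally show ?case using cSUP_least[OF ne le] by simp
      qed
    qed
  qed
  show ?thesis using i ii iii iv unfolding Z_def W_def Zbar_def by blast
qed

end
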